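(* Let $q$ be a power of a prime $p$. Let $X$ be a subset of the point set of $\mathrm{PG}(2,q)$ whose characteristic vector is a codeword of $C_1(2,q)$, and let $Q$ be a point of $\mathrm{PG}(2,q)$. Let $\lambda$ be an integer with $\lambda\le\min\{q-2,p-1\}$ and let $\mathcal{E}_\lambda$ be a non-empty set of lines through $Q$, each of them incident with at most $\lambda$ points of $X\setminus\{Q\}$. Then the points of $X\setminus\{Q\}$ incident with lines of $\mathcal{E}_\lambda$ are on a curve of degree $\lambda$.
   Context: $C_1(2,q)$ denotes the $p$-ary linear code generated by the incidence (characteristic) vectors of the lines of $\mathrm{PG}(2,q)$, i.e. the $\mathbb{F}_p$-span of these vectors inside the space of $\mathbb{F}_p$-valued functions on the points of $\mathrm{PG}(2,q)$. A curve of degree $n$ is an algebraic curve of $\mathrm{PG}(2,q)$ given by a nonzero homogeneous polynomial in $\mathbb{F}_q[X,Y,Z]$ of degree $n$; a point is on the curve if the polynomial vanishes at it. *)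

theory Defs
  imports
    "HOL-Analysis.Analysis"
    "HOL-Computational_Algebra.Primes"
    "HOL-Library.Function_Algebras"
    "HOL-Library.Poly_Mapping"
begin

(* PG(2,q), with q = CARD('a), is the lattice of linear subspaces of 'a^3: points and lines are the
   subspaces of vector space dimension 1 and 2.  A line is therefore a set of vectors, not a set of
   points, and incidence of a point P with a line l is the inclusion P \<subseteq> l. *)

definition pg_points :: "('a::field ^ 3) set set" where
  "pg_points = {P. vec.subspace P \<and> vec.dim P = 1}"

definition pg_lines :: "('a::field ^ 3) set set" where
  "pg_lines = {l. vec.subspace l \<and> vec.dim l = 2}"

interpretation fun_space: vector_space "\<lambda>(c::'k::field) (f::'b \<Rightarrow> 'k) x. c * f x"
  by unfold_locales (simp_all add: fun_eq_iff algebra_simps)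

definition char_vec :: "'b set \<Rightarrow> 'b \<Rightarrow> 'k::zero_neq_one" where
  "char_vec S P = (if P \<in> S then 1 else 0)"

(* A function on the points of PG(2,q) is encoded as a function on all sets of vectors that
   vanishes outside pg_points. All generators, hence all codewords, have this property.
   The alphabet 'k is independent of 'a; C_1(2,q) is the case where 'k has p elements, p being
   the characteristic of 'a. *)

definition line_code :: "(('a::field ^ 3) set \<Rightarrow> 'k::field) set" where
  "line_code = fun_space.span ((\<lambda>l. char_vec {P \<in> pg_points. P \<subseteq> l}) ` pg_lines)"

(* Polynomials in X, Y, Z are finitely supported families of coefficients indexed by
   monomials, and a monomial is the family of its three exponents. *)

type_synonym 'a poly3 = "(3 \<Rightarrow>\<^sub>0 nat) \<Rightarrow>\<^sub>0 'a"

definition poly3_eval :: "'a::comm_semiring_1 poly3 \<Rightarrow> 'a ^ 3 \<Rightarrow> 'a" where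
  "poly3_eval f v =
    (\<Sum>m\<in>Poly_Mapping.keys f. Poly_Mapping.lookup f m * (\<Prod>i\<in>UNIV. (v $ i) ^ Poly_Mapping.lookup m i))"

definition homogeneous3 :: "nat \<Rightarrow> 'a::zero poly3 \<Rightarrow> bool" where
  "homogeneous3 n f \<longleftrightarrow>
    (\<forall>m\<in>Poly_Mapping.keys f. (\<Sum>i\<in>UNIV. Poly_Mapping.lookup m i) = n)"

definition pg_curve :: "nat \<Rightarrow> 'a::zero poly3 \<Rightarrow> bool" where
  "pg_curve n f \<longleftrightarrow> f \<noteq> 0 \<and> homogeneous3 n f"

(* The nonzero vectors of a point are its homogeneous coordinate vectors; 0 is left out because
   it is a zero of every form of positive degree. *)

definition on_curve :: "('a::field ^ 3) set \<Rightarrow> 'a poly3 \<Rightarrow> bool" where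
  "on_curve P f \<longleftrightarrow> (\<forall>v\<in>P - {0}. poly3_eval f v = 0)"

end

theory Submission
  imports Defs "HOL-Number_Theory.Cong" "HOL-Computational_Algebra.Formal_Power_Series"
begin

text \<open>Let \<open>v\<close> span \<open>Q\<close>, with some coordinate \<open>v\<^sub>i = 1\<close>. For \<open>w\<close> outside \<open>Q\<close>, the points other than \<open>Q\<close>
  of the line joining \<open>w\<close> and \<open>Q\<close> are spanned by \<open>w + (t - w\<^sub>i) v\<close>. For \<open>1 \<le> k \<le> q - 2\<close> the sum
  of \<open>t ^ k\<close> over those \<open>t\<close> whose point is in \<open>X\<close> is a form of degree \<open>k\<close> in \<open>w\<close>: by linearity
  it suffices to replace \<open>X\<close> by a line, which gives the \<open>k\<close>-th power of a linear form if the line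
  misses \<open>Q\<close>, and otherwise 0 or the sum of all \<open>t ^ k\<close>, which is 0 too. Newton's identities turn
  these power sums into elementary symmetric functions for \<open>k < p\<close>, so on the lines of \<open>E\<close> the
  \<open>k\<close>-th elementary symmetric function is a form \<open>H\<^sub>k(w)\<close> of degree \<open>k\<close>. The curve is the sum of
  \<open>(-1) ^ k H\<^sub>k(w) w\<^sub>i ^ (lam - k)\<close>; it takes the value 1 at \<open>v\<close> since all \<open>H\<^sub>k\<close> with \<open>k > 0\<close>
  vanish there.\<close>

section \<open>Power sums and elementary symmetric functions\<close>

text \<open>The generating function of the elementary symmetric functions of the elements of a
  finite \<open>B\<close>: its coefficient at \<open>k\<close> is the \<open>k\<close>-th of
  them.\<close>

definition esym_fps :: "'a::field set \<Rightarrow> 'a fps" where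
  "esym_fps B = (\<Prod>b\<in>B. 1 + fps_const b * fps_X)"

text \<open>For finite \<open>B\<close> this is the sum over \<open>b\<close> of the expansions of
  \<open>b X / (1 + b X)\<close>, that is, \<open>X\<close> times the logarithmic derivative of
  \<open>esym_fps B\<close>. The constant coefficient is 0 even though the empty power would
  contribute \<open>card B\<close>.\<close>

definition power_sum_fps :: "'a::field set \<Rightarrow> 'a fps" where
  "power_sum_fps B = Abs_fps (\<lambda>k. if k = 0 then 0 else (-1) ^ (k - 1) * (\<Sum>b\<in>B. b ^ k))"

lemma esym_fps_insert:
  assumes "finite B" "b \<notin> B"
  shows "esym_fps (insert b B) = (1 + fps_const b * fps_X) * esym_fps B"
  using assms by (simp add: esym_fps_def)

abbreviation esym :: "'a::field set \<Rightarrow> nat \<Rightarrow> 'a" where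
  "esym B k \<equiv> fps_nth (esym_fps B) k"

lemma esym_insert_Suc:
  assumes "finite B" "b \<notin> B"
  shows "esym (insert b B) (Suc k) = esym B (Suc k) + b * esym B k"
  using assms by (simp add: esym_fps_insert distrib_right mult.assoc)

lemma esym_0 [simp]: "esym B 0 = (1 :: 'a::field)"
proof (cases "finite B")
  case True
  then show ?thesis
    by (induction B) (simp_all add: esym_fps_insert, simp add: esym_fps_def)
qed (simp add: esym_fps_def)

lemma esym_eq_0:
  assumes "finite B" "card B < k"
  shows "esym B k = (0 :: 'a::field)"
  using assms
proof (induction B arbitrary: k)
  case empty
  then show ?case by (simp add: esym_fps_def)
next
  case (insert b B)
  then obtain j where "k = Suc j" by (cases k) auto
  then show ?case using insert by (simp add: esym_insert_Suc)
qed

lemma power_sum_fps_insert: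
  assumes "finite B" "b \<notin> B"
  shows "power_sum_fps (insert b B) = power_sum_fps {b} + power_sum_fps B"
  using assms by (simp add: power_sum_fps_def fps_eq_iff algebra_simps)

lemma power_sum_fps_single:
  "(1 + fps_const b * fps_X) * power_sum_fps {b} = fps_const b * (fps_X :: 'a::field fps)"
proof (rule fps_ext)
  fix n
  show "fps_nth ((1 + fps_const b * fps_X) * power_sum_fps {b}) n = fps_nth (fps_const b * (fps_X :: 'a fps)) n"
  proof (cases n)
    case (Suc m)
    then show ?thesis
      by (cases m) (simp_all add: power_sum_fps_def distrib_right mult.assoc)
  qed (simp add: power_sum_fps_def distrib_right mult.assoc)
qed

text \<open>Newton's identities in generating form: \<open>X\<close> times a logarithmic derivative
  turns the product over \<open>B\<close> into a sum, so adjoining \<open>b\<close> adds just the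
  term \<open>power_sum_fps {b}\<close>.\<close>

lemma newton_fps:
  assumes "finite (B :: 'a::field set)"
  shows "fps_X * fps_deriv (esym_fps B) = esym_fps B * power_sum_fps B"
  using assms
proof (induction B)
  case empty
  then show ?case by (simp add: esym_fps_def power_sum_fps_def fps_eq_iff fps_mult_nth)
next
  case (insert b B)
  let ?u = "1 + fps_const b * fps_X"
  have d: "fps_deriv ?u = fps_const b" by simp
  have "fps_X * fps_deriv (?u * esym_fps B)
      = (fps_const b * fps_X) * esym_fps B + ?u * (fps_X * fps_deriv (esym_fps B))"
    unfolding fps_deriv_mult d by (simp add: algebra_simps)
  also have "\<dots> = (?u * power_sum_fps {b}) * esym_fps B + ?u * (esym_fps B * power_sum_fps B)"
    by (simp only: power_sum_fps_single insert.IH)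
  also have "\<dots> = ?u * esym_fps B * power_sum_fps (insert b B)"
    unfolding power_sum_fps_insert[OF insert.hyps] by (simp add: algebra_simps)
  finally show ?case by (simp add: esym_fps_insert insert.hyps)
qed

text \<open>Coefficients at \<open>k\<close> in \<open>newton_fps\<close> are compared. The term
  \<open>i = k\<close> drops out because \<open>power_sum_fps\<close> has constant coefficient 0. No
  division by \<open>k\<close> occurs, so this is valid in every characteristic.\<close>

lemma newton_identity:
  assumes "finite (B :: 'a::field set)" "k > 0"
  shows "of_nat k * esym B k
    = (\<Sum>i<k. (-1) ^ (k - i - 1) * (esym B i * (\<Sum>b\<in>B. b ^ (k - i))))"
proof -
  have "of_nat k * esym B k = fps_nth (fps_X * fps_deriv (esym_fps B)) k"
    using \<open>k > 0\<close> by simp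
  also have "\<dots> = (\<Sum>i\<le>k. esym B i * fps_nth (power_sum_fps B) (k - i))"
    unfolding newton_fps[OF assms(1)] fps_mult_nth atLeast0AtMost ..
  also have "\<dots> = (\<Sum>i<k. esym B i * fps_nth (power_sum_fps B) (k - i))"
    by (simp add: power_sum_fps_def flip: lessThan_Suc_atMost)
  also have "\<dots> = (\<Sum>i<k. (-1) ^ (k - i - 1) * (esym B i * (\<Sum>b\<in>B. b ^ (k - i))))"
    by (intro sum.cong) (simp_all add: power_sum_fps_def)
  finally show ?thesis .
qed

text \<open>The sum is the product of the \<open>t - b\<close> over \<open>b \<in> B\<close>, times
  \<open>t ^ (n - card B)\<close>, and one factor is 0. In the proof, the partial sums up to
  \<open>m\<close> collapse to a single elementary symmetric function of \<open>B - {t}\<close>,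
  which vanishes at \<open>m = n\<close> because that set has fewer than \<open>n\<close>
  elements.\<close>

lemma esym_root:
  assumes "finite (B :: 'a::field set)" "t \<in> B" "card B \<le> n"
  shows "(\<Sum>k\<le>n. (-1) ^ k * esym B k * t ^ (n - k)) = 0"
proof -
  define C where "C = B - {t}"
  have C: "finite C" "t \<notin> C" "insert t C = B" "card C < n"
    using assms card_Diff1_less[of B t] by (auto simp: C_def)
  have "(\<Sum>k\<le>m. (-1) ^ k * esym (insert t C) k * t ^ (m - k)) = (-1) ^ m * esym C m" for m
  proof (induction m)
    case (Suc m)
    have "(\<Sum>k\<le>m. (-1) ^ k * esym (insert t C) k * t ^ (Suc m - k))
        = t * (\<Sum>k\<le>m. (-1) ^ k * esym (insert t C) k * t ^ (m - k))"
      unfolding sum_distrib_left by (intro sum.cong) (auto simp: Suc_diff_le)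
    also have "\<dots> = t * ((-1) ^ m * esym C m)" unfolding Suc ..
    finally have "(\<Sum>k\<le>Suc m. (-1) ^ k * esym (insert t C) k * t ^ (Suc m - k))
        = t * ((-1) ^ m * esym C m) + (-1) ^ Suc m * (esym C (Suc m) + t * esym C m)"
      using C(1,2) by (simp add: esym_insert_Suc)
    then show ?case by (simp add: distrib_left mult_ac)
  qed simp
  from this[of n] show ?thesis
    unfolding C(3) esym_eq_0[OF C(1,4)] by simp
qed

text \<open>Multiplication by a nonzero \<open>a\<close> permutes the field and multiplies the sum
  by \<open>a ^ k\<close>. Some \<open>a\<close> has \<open>a ^ k \<noteq> 1\<close>, since
  \<open>x ^ k - 1\<close> has at most \<open>k\<close> roots, fewer than the number of nonzero
  elements.\<close>

lemma sum_power_finite_field: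
  assumes "0 < k" "k + 2 \<le> CARD('a::{field,finite})"
  shows "(\<Sum>t\<in>UNIV. (t :: 'a) ^ k) = 0"
proof -
  have "\<exists>a::'a. a \<noteq> 0 \<and> a ^ k \<noteq> 1"
  proof (rule ccontr)
    assume "\<not> ?thesis"
    then have sub: "UNIV - {0} \<subseteq> {x::'a. poly (monom 1 k - 1) x = 0}"
      by (auto simp: poly_monom)
    have deg: "degree (monom 1 k - 1 :: 'a poly) \<le> k"
      by (intro degree_diff_le) (auto intro: degree_monom_le)
    have nz: "monom 1 k - 1 \<noteq> (0 :: 'a poly)"
    proof
      assume "monom 1 k - 1 = (0 :: 'a poly)"
      then have "degree (monom 1 k :: 'a poly) = 0" by simp
      then show False using assms(1) by (simp add: degree_monom_eq)
    qed
    have "card (UNIV - {0::'a}) \<le> k"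
      using card_mono[OF poly_roots_finite[OF nz] sub] card_poly_roots_bound[OF nz] deg by linarith
    then show False using assms(2) by simp
  qed
  then obtain a :: 'a where a: "a \<noteq> 0" "a ^ k \<noteq> 1" by blast
  have "(\<Sum>t\<in>UNIV. t ^ k) = (\<Sum>t\<in>UNIV. (a * t) ^ k)"
    by (rule sum.reindex_bij_witness[of _ "\<lambda>t. a * t" "\<lambda>t. t / a"]) (use a in simp_all)
  also have "\<dots> = a ^ k * (\<Sum>t\<in>UNIV. t ^ k)"
    unfolding power_mult_distrib sum_distrib_left ..
  finally show ?thesis using a by simp
qed

section \<open>Forms as functions\<close>

definition monomial3 :: "(3 \<Rightarrow>\<^sub>0 nat) \<Rightarrow> 'a::field ^ 3 \<Rightarrow> 'a" where
  "monomial3 m v = (\<Prod>i\<in>UNIV. (v $ i) ^ Poly_Mapping.lookup m i)"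

text \<open>Forms are treated as functions, on which sums and products are pointwise. Over a finite
  field different polynomials can induce the same function, so a polynomial is chosen only at the
  end, and a nonzero value shows that it is nonzero.\<close>

definition forms :: "nat \<Rightarrow> ('a::field ^ 3 \<Rightarrow> 'a) set" where
  "forms n = fun_space.span (monomial3 ` {m. (\<Sum>i\<in>UNIV. Poly_Mapping.lookup m i) = n})"

lemma poly3_eval_superset:
  assumes "finite S" "Poly_Mapping.keys f \<subseteq> S"
  shows "poly3_eval f v = (\<Sum>m\<in>S. Poly_Mapping.lookup f m * monomial3 m v)"
  unfolding poly3_eval_def monomial3_def
  by (rule sum.mono_neutral_left) (use assms in \<open>auto simp: in_keys_iff\<close>)

lemma poly3_eval_add: "poly3_eval (f + g) v = poly3_eval f v + poly3_eval g (v :: 'a::field ^ 3)"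
proof -
  let ?S = "Poly_Mapping.keys f \<union> Poly_Mapping.keys g"
  have "finite ?S" by simp
  then show ?thesis
    using keys_add[of f g]
    by (simp add: poly3_eval_superset[of ?S] lookup_add distrib_right sum.distrib)
qed

lemma poly3_eval_single: "poly3_eval (Poly_Mapping.single m c) v = c * monomial3 m (v :: 'a::field ^ 3)"
  by (subst poly3_eval_superset[of "{m}"]) auto

lemma forms_poly3:
  assumes "G \<in> forms n"
  shows "\<exists>f. homogeneous3 n f \<and> (\<forall>v. poly3_eval f v = G v)"
  using assms unfolding forms_def
proof (induction rule: fun_space.span_induct_alt)
  case base
  show ?case by (rule exI[of _ 0]) (simp add: homogeneous3_def poly3_eval_def)
next
  case (step c x y)
  then obtain m f where m: "(\<Sum>i\<in>UNIV. Poly_Mapping.lookup m i) = n" "x = monomial3 m"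
    and f: "homogeneous3 n f" "\<forall>v. poly3_eval f v = y v" by auto
  have "Poly_Mapping.keys (Poly_Mapping.single m c + f) \<subseteq> insert m (Poly_Mapping.keys f)"
    using keys_add[of "Poly_Mapping.single m c" f] by (auto split: if_splits)
  then have "homogeneous3 n (Poly_Mapping.single m c + f)"
    using f(1) m(1) unfolding homogeneous3_def by blast
  then show ?case
    using f(2) m(2)
    by (intro exI[of _ "Poly_Mapping.single m c + f"]) (simp add: poly3_eval_add poly3_eval_single)
qed

lemma monomial3_in_forms: "monomial3 m \<in> forms (\<Sum>i\<in>UNIV. Poly_Mapping.lookup m i)"
  unfolding forms_def by (intro fun_space.span_base) auto

lemma forms_0: "0 \<in> forms n"
  and forms_add: "F \<in> forms n \<Longrightarrow> G \<in> forms n \<Longrightarrow> F + G \<in> forms n"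
  and forms_scale: "F \<in> forms n \<Longrightarrow> (\<lambda>v. c * F v) \<in> forms n"
  unfolding forms_def
  by (rule fun_space.span_zero fun_space.span_add fun_space.span_scale; assumption?)+

lemma forms_mult:
  assumes "F \<in> forms m" "G \<in> forms n"
  shows "F * G \<in> forms (m + n)"
proof -
  have mono: "monomial3 a * H \<in> forms (m + n)"
    if a: "(\<Sum>i\<in>UNIV. Poly_Mapping.lookup a i) = m" and H: "H \<in> forms n" for a H
    using H unfolding forms_def[of n]
  proof (induction rule: fun_space.span_induct_alt)
    case (step c x y)
    then obtain b where b: "(\<Sum>i\<in>UNIV. Poly_Mapping.lookup b i) = n" "x = monomial3 b" by auto
    have "monomial3 a * ((\<lambda>v. c * x v) + y) = (\<lambda>v. c * monomial3 (a + b) v) + monomial3 a * y"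
      by (rule ext)
        (simp add: b monomial3_def lookup_add power_add prod.distrib algebra_simps)
    moreover have "monomial3 (a + b) \<in> forms (m + n)"
      using monomial3_in_forms[of "a + b"] a b by (simp add: lookup_add sum.distrib)
    ultimately show ?case using step(2) by (simp only:) (intro forms_add forms_scale)
  qed (simp only: mult_zero_left mult_zero_right forms_0)
  show ?thesis
    using assms(1) unfolding forms_def[of m]
  proof (induction rule: fun_space.span_induct_alt)
    case (step c x y)
    have "((\<lambda>v. c * x v) + y) * G = (\<lambda>v. c * (x * G) v) + y * G"
      by (rule ext) (simp add: algebra_simps)
    moreover have "x * G \<in> forms (m + n)" using step(1) mono assms(2) by auto
    ultimately show ?case using step(2) by (simp only:) (intro forms_add forms_scale)
  qed (simp only: mult_zero_left mult_zero_right forms_0)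
qed

lemma forms_one: "1 \<in> forms 0"
proof -
  have "monomial3 0 = (1 :: 'a ^ 3 \<Rightarrow> 'a)" by (rule ext) (simp add: monomial3_def)
  then show ?thesis using monomial3_in_forms[of 0, where 'a = 'a] by simp
qed

lemma forms_coordinate: "(\<lambda>v. v $ i) \<in> forms 1"
proof -
  have "monomial3 (Poly_Mapping.single i 1) = (\<lambda>v :: 'a ^ 3. v $ i)"
  proof
    fix v :: "'a ^ 3"
    have "monomial3 (Poly_Mapping.single i 1) v = (\<Prod>j\<in>UNIV. if j = i then v $ j else 1)"
      unfolding monomial3_def by (intro prod.cong) (auto simp: lookup_single when_def)
    then show "monomial3 (Poly_Mapping.single i 1) v = v $ i" by simp
  qed
  then show ?thesis
    using monomial3_in_forms[of "Poly_Mapping.single i (1::nat)", where 'a = 'a]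
    by (simp add: lookup_single when_def)
qed

lemma forms_linear:
  fixes \<phi> :: "'a::field ^ 3 \<Rightarrow> 'a"
  assumes add: "\<And>v w. \<phi> (v + w) = \<phi> v + \<phi> w" and scale: "\<And>c v. \<phi> (c *s v) = c * \<phi> v"
  shows "\<phi> \<in> forms 1"
proof -
  have eq: "\<phi> = (\<lambda>v. \<phi> (axis 1 1) * v $ 1) + (\<lambda>v. \<phi> (axis 2 1) * v $ 2) + (\<lambda>v. \<phi> (axis 3 1) * v $ 3)"
  proof
    fix v :: "'a ^ 3"
    have "v = v $ 1 *s axis 1 1 + v $ 2 *s axis 2 1 + v $ 3 *s axis 3 1"
      by (simp add: vec_eq_iff forall_3 axis_def)
    then have "\<phi> v = \<phi> (v $ 1 *s axis 1 1 + v $ 2 *s axis 2 1 + v $ 3 *s axis 3 1)" by simp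
    then show "\<phi> v = ((\<lambda>v. \<phi> (axis 1 1) * v $ 1) + (\<lambda>v. \<phi> (axis 2 1) * v $ 2)
        + (\<lambda>v. \<phi> (axis 3 1) * v $ 3)) v"
      by (simp add: add scale mult.commute)
  qed
  show ?thesis
    by (subst eq) (intro forms_add forms_scale forms_coordinate)
qed

lemma forms_power:
  assumes "F \<in> forms m"
  shows "(\<lambda>v. F v ^ k) \<in> forms (m * k)"
proof (induction k)
  case 0
  then show ?case using forms_one by (simp add: one_fun_def)
next
  case (Suc k)
  then show ?case using forms_mult[OF assms Suc] by (simp add: times_fun_def)
qed

lemma forms_sum:
  assumes "\<And>i. i \<in> I \<Longrightarrow> F i \<in> forms n"
  shows "(\<lambda>v. \<Sum>i\<in>I. F i v) \<in> forms n"
  using assms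
proof (induction I rule: infinite_finite_induct)
  case (insert i I)
  then show ?case using forms_add[of "F i" n "\<lambda>v. \<Sum>i\<in>I. F i v"] by (simp add: plus_fun_def)
qed (use forms_0 in \<open>simp_all add: zero_fun_def\<close>)

text \<open>The vanishing at \<open>v\<close> serves only to show that the final form is nonzero.\<close>

definition forms_at :: "'a::field ^ 3 \<Rightarrow> nat \<Rightarrow> ('a ^ 3 \<Rightarrow> 'a) set" where
  "forms_at v n = {F \<in> forms n. 0 < n \<longrightarrow> F v = 0}"

lemma forms_at_mult: "F \<in> forms_at v m \<Longrightarrow> G \<in> forms_at v n \<Longrightarrow> F * G \<in> forms_at v (m + n)"
  by (auto simp: forms_at_def forms_mult)

lemma forms_at_scale: "F \<in> forms_at v n \<Longrightarrow> (\<lambda>w. c * F w) \<in> forms_at v n"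
  by (auto simp: forms_at_def forms_scale)

lemma forms_at_add: "F \<in> forms_at v n \<Longrightarrow> G \<in> forms_at v n \<Longrightarrow> F + G \<in> forms_at v n"
  by (auto simp: forms_at_def forms_add)

lemma forms_at_sum:
  assumes "\<And>i. i \<in> I \<Longrightarrow> F i \<in> forms_at v n"
  shows "(\<lambda>w. \<Sum>i\<in>I. F i w) \<in> forms_at v n"
  using assms by (auto simp: forms_at_def intro: forms_sum)

text \<open>Newton's identity gives \<open>k\<close> times the \<open>k\<close>-th elementary
  symmetric function in terms of lower ones and power sums, and \<open>char\<close> allows division
  by \<open>k\<close>. The agreement is claimed only on \<open>D\<close>. Degree 0 carries the extra
  clause \<open>H v = 1\<close> because \<open>forms_at\<close> does not constrain the value of a
  constant at \<open>v\<close>.\<close>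

lemma esym_forms:
  fixes B :: "'a::field ^ 3 \<Rightarrow> 'a set"
  assumes fin: "\<And>w. w \<in> D \<Longrightarrow> finite (B w)"
    and char: "\<And>k. 0 < k \<Longrightarrow> k \<le> n \<Longrightarrow> of_nat k \<noteq> (0 :: 'a)"
    and psum: "\<And>k. 0 < k \<Longrightarrow> k \<le> n \<Longrightarrow> \<exists>G \<in> forms_at v k. \<forall>w\<in>D. (\<Sum>b\<in>B w. b ^ k) = G w"
  shows "k \<le> n \<Longrightarrow> \<exists>H \<in> forms_at v k. (\<forall>w\<in>D. esym (B w) k = H w) \<and> (k = 0 \<longrightarrow> H v = 1)"
proof (induction k rule: less_induct)
  case (less k)
  show ?case
  proof (cases "k = 0")
    case True
    then show ?thesis using forms_one by (intro bexI[of _ 1]) (auto simp: forms_at_def)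
  next
    case False
    have "\<forall>i. \<exists>H. i < k \<longrightarrow> H \<in> forms_at v i \<and> (\<forall>w\<in>D. esym (B w) i = H w)"
      using less by fastforce
    then obtain H where H: "\<And>i. i < k \<Longrightarrow> H i \<in> forms_at v i"
      "\<And>i w. i < k \<Longrightarrow> w \<in> D \<Longrightarrow> esym (B w) i = H i w" by metis
    have "\<forall>i. \<exists>G. 0 < i \<and> i \<le> k \<longrightarrow> G \<in> forms_at v i \<and> (\<forall>w\<in>D. (\<Sum>b\<in>B w. b ^ i) = G w)"
      using psum less.prems by (meson order_trans)
    then obtain G where G: "\<And>i. 0 < i \<Longrightarrow> i \<le> k \<Longrightarrow> G i \<in> forms_at v i"
      "\<And>i w. 0 < i \<Longrightarrow> i \<le> k \<Longrightarrow> w \<in> D \<Longrightarrow> (\<Sum>b\<in>B w. b ^ i) = G i w" by metis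
    define K where "K = (\<lambda>w. inverse (of_nat k)
      * (\<Sum>i<k. (-1) ^ (k - i - 1) * (H i * G (k - i)) w))"
    have "K \<in> forms_at v k"
      unfolding K_def
    proof (intro forms_at_scale forms_at_sum)
      fix i assume "i \<in> {..<k}"
      then show "H i * G (k - i) \<in> forms_at v k"
        using forms_at_mult[OF H(1)[of i] G(1)[of "k - i"]] by simp
    qed
    moreover have "esym (B w) k = K w" if "w \<in> D" for w
    proof -
      have "of_nat k * esym (B w) k = (\<Sum>i<k. (-1) ^ (k - i - 1) * (H i * G (k - i)) w)"
        using newton_identity[OF fin[OF that], of k] False H(2) G(2) that by simp
      then show ?thesis
        using char[of k] False less.prems by (simp add: K_def field_simps)
    qed
    ultimately show ?thesis using False by blast
  qed
qed

section \<open>Points, lines and codewords\<close>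

lemma pg_point_eq_span:
  assumes "P \<in> pg_points" "v \<in> P" "v \<noteq> 0"
  shows "P = vec.span {v}"
proof -
  have P: "vec.subspace P" "vec.dim P = 1" using assms by (auto simp: pg_points_def)
  have "vec.span {v} = P"
    by (rule vec.subspace_dim_equal) (use P assms in \<open>simp_all add: vec.span_minimal\<close>)
  then show ?thesis ..
qed

lemma span_in_pg_points: "v \<noteq> 0 \<Longrightarrow> vec.span {v} \<in> pg_points"
  by (simp add: pg_points_def)

lemma pg_lines_span_subset_iff: "l \<in> pg_lines \<Longrightarrow> vec.span {v} \<subseteq> l \<longleftrightarrow> v \<in> l"
  using vec.span_minimal[of "{v}" l] vec.span_base[of v "{v}"] by (auto simp: pg_lines_def)

lemma add_scale_notin_span:
  assumes "w \<notin> vec.span {v}"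
  shows "w + c *s v \<notin> vec.span {v}"
proof
  assume "w + c *s v \<in> vec.span {v}"
  from vec.span_diff[OF this vec.span_scale[OF vec.span_base[of v], of _ c]]
  have "w + c *s v - c *s v \<in> vec.span {v}" by simp
  then show False using assms by simp
qed

text \<open>The whole space is the direct sum of \<open>l\<close> and the span of \<open>v\<close>,
  and \<open>\<phi>\<close> is minus the \<open>v\<close>-component. So each coset of the span of
  \<open>v\<close> meets \<open>l\<close> exactly once, and this uniqueness makes
  \<open>\<phi>\<close> linear.\<close>

lemma pg_line_functional:
  assumes "l \<in> pg_lines" "v \<notin> l"
  obtains \<phi> :: "'a::field ^ 3 \<Rightarrow> 'a" where
    "\<And>a b. \<phi> (a + b) = \<phi> a + \<phi> b" "\<And>c a. \<phi> (c *s a) = c * \<phi> a"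
    "\<And>w t. w + t *s v \<in> l \<longleftrightarrow> t = \<phi> w"
proof -
  have l: "vec.subspace l" "vec.dim l = 2" using assms by (auto simp: pg_lines_def)
  have span_l: "vec.span l = l" using l by simp
  have "vec.dim (insert v l) = 3"
    using l assms(2) unfolding vec.dim_insert span_l by simp
  then have "vec.span (insert v l) = UNIV"
    unfolding vec.dim_eq_full[symmetric] vec.dimension_def card_cart_basis by simp
  then have ex: "\<exists>t. w + t *s v \<in> l" for w
  proof -
    have "w \<in> vec.span (insert v l)" using \<open>vec.span (insert v l) = UNIV\<close> by simp
    then obtain k where "w - k *s v \<in> l"
      unfolding vec.span_insert span_l by blast
    then have "w + (- k) *s v \<in> l" by simp
    then show ?thesis by blast
  qed
  have unique: "s = t" if "w + s *s v \<in> l" "w + t *s v \<in> l" for w s t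
  proof (rule ccontr)
    assume "s \<noteq> t"
    have "(w + s *s v) - (w + t *s v) \<in> l" using l that by (intro vec.subspace_diff)
    then have "(s - t) *s v \<in> l" by (simp add: vec.scale_left_diff_distrib)
    then have "inverse (s - t) *s ((s - t) *s v) \<in> l"
      by (rule vec.subspace_scale[OF l(1)])
    then show False using assms(2) \<open>s \<noteq> t\<close> unfolding vec.scale_scale by simp
  qed
  from ex obtain \<phi> where \<phi>: "\<And>w. w + \<phi> w *s v \<in> l" by metis
  have iff: "w + t *s v \<in> l \<longleftrightarrow> t = \<phi> w" for w t
    using \<phi> unique by blast
  show thesis
  proof (rule that[OF _ _ iff])
    fix a b
    have "(a + \<phi> a *s v) + (b + \<phi> b *s v) \<in> l" by (rule vec.subspace_add[OF l(1) \<phi> \<phi>])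
    then have "(a + b) + (\<phi> a + \<phi> b) *s v \<in> l"
      by (simp add: vec.scale_left_distrib algebra_simps)
    then show "\<phi> (a + b) = \<phi> a + \<phi> b" using iff by metis
  next
    fix c a
    have "c *s (a + \<phi> a *s v) \<in> l" by (rule vec.subspace_scale[OF l(1) \<phi>])
    then have "c *s a + (c * \<phi> a) *s v \<in> l" by (simp add: vec.scale_right_distrib)
    then show "\<phi> (c *s a) = c * \<phi> a" using iff by metis
  qed
qed

section \<open>Power sums of codewords along the lines through a point\<close>

text \<open>As \<open>v $ i = 1\<close>, the parameter \<open>t\<close> is the \<open>i\<close>-th
  coordinate of \<open>w + (t - w $ i) *s v\<close>. If \<open>v \<notin> l\<close>, the only
  admissible \<open>t\<close> is \<open>\<phi> w + w $ i\<close>; the shift by \<open>w $ i\<close>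
  makes this linear form vanish at \<open>v\<close>, where \<open>\<phi>\<close> is -1. If
  \<open>v \<in> l\<close>, a coset of the span of \<open>v\<close> lies in \<open>l\<close> or
  misses it.\<close>

lemma line_power_sum:
  fixes v :: "'a::{field,finite} ^ 3"
  assumes "v $ i = 1" "l \<in> pg_lines" "0 < k" "k + 2 \<le> CARD('a)"
  shows "\<exists>G \<in> forms_at v k. \<forall>w. (\<Sum>t | w + (t - w $ i) *s v \<in> l. t ^ k) = G w"
proof (cases "v \<in> l")
  case True
  have l: "vec.subspace l" using assms by (auto simp: pg_lines_def)
  have "w + c *s v \<in> l \<longleftrightarrow> w \<in> l" for w c
  proof
    assume "w + c *s v \<in> l"
    then have "w + c *s v - c *s v \<in> l"
      using l True by (intro vec.subspace_diff vec.subspace_scale)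
    then show "w \<in> l" by simp
  qed (use l True in \<open>intro vec.subspace_add vec.subspace_scale\<close>)
  then have "(\<Sum>t | w + (t - w $ i) *s v \<in> l. t ^ k) = (\<Sum>t | w \<in> l. t ^ k)" for w
    by (simp only:)
  also have "(\<Sum>t :: 'a | w \<in> l. t ^ k) = 0" for w
    using sum_power_finite_field[OF assms(3,4)] by (cases "w \<in> l") simp_all
  finally have "(\<Sum>t | w + (t - w $ i) *s v \<in> l. t ^ k) = 0" for w .
  then show ?thesis by (intro bexI[of _ 0]) (auto simp: forms_at_def forms_0)
next
  case False
  obtain \<phi> where add: "\<And>a b. \<phi> (a + b) = \<phi> a + \<phi> b" and scale: "\<And>c a. \<phi> (c *s a) = c * \<phi> a"
    and iff: "\<And>w t. w + t *s v \<in> l \<longleftrightarrow> t = \<phi> w"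
    using pg_line_functional[OF assms(2) False] by blast
  define \<psi> where "\<psi> = (\<lambda>w. \<phi> w + w $ i)"
  have "\<psi> \<in> forms 1"
    by (rule forms_linear) (simp_all add: \<psi>_def add scale algebra_simps)
  then have "(\<lambda>w. \<psi> w ^ k) \<in> forms k" using forms_power by fastforce
  moreover have "\<psi> v = 0"
  proof -
    have "v + (- 1) *s v = 0" by (simp add: vec_eq_iff)
    then have "v + (- 1) *s v \<in> l"
      using assms(2) vec.subspace_0[of l] by (simp add: pg_lines_def)
    then have "\<phi> v = - 1" unfolding iff by simp
    then show ?thesis using assms(1) by (simp add: \<psi>_def)
  qed
  moreover have "{t. w + (t - w $ i) *s v \<in> l} = {\<psi> w}" for w
    unfolding iff \<psi>_def by (auto simp: algebra_simps)
  ultimately show ?thesis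
    using assms(3) by (intro bexI[of _ "\<lambda>w. \<psi> w ^ k"]) (auto simp: forms_at_def)
qed

text \<open>The alphabet and the coordinate field are different types of the same characteristic, so
  a codeword is transported from one to the other through natural numbers.\<close>

lemma line_code_power_sums:
  fixes v :: "'a::{field,finite} ^ 3" and f :: "('a ^ 3) set \<Rightarrow> 'k::field"
  assumes "v $ i = 1" and surj: "surj (of_nat :: nat \<Rightarrow> 'k)" and "f \<in> line_code"
  shows "\<exists>g. (\<forall>P. f P = of_nat (g P)) \<and> (\<forall>k. 0 < k \<longrightarrow> k + 2 \<le> CARD('a) \<longrightarrow>
    (\<exists>G \<in> forms_at v k. \<forall>w. w \<notin> vec.span {v} \<longrightarrow>
      (\<Sum>t\<in>UNIV. of_nat (g (vec.span {w + (t - w $ i) *s v})) * t ^ k) = G w))"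
  using assms(3) unfolding line_code_def
proof (induction rule: fun_space.span_induct_alt)
  case base
  show ?case
    using forms_0 by (intro exI[of _ "\<lambda>_. 0"]) (fastforce simp: forms_at_def intro: bexI[of _ 0])
next
  case (step c x y)
  then obtain l where l: "l \<in> pg_lines" and x: "x = char_vec {P \<in> pg_points. P \<subseteq> l}" by blast
  obtain n where c: "c = of_nat n" using surj by (metis surjD)
  obtain g where g: "\<And>P. y P = of_nat (g P)"
    and psum: "\<And>k. 0 < k \<Longrightarrow> k + 2 \<le> CARD('a) \<Longrightarrow> \<exists>G \<in> forms_at v k. \<forall>w. w \<notin> vec.span {v} \<longrightarrow>
      (\<Sum>t\<in>UNIV. of_nat (g (vec.span {w + (t - w $ i) *s v})) * t ^ k) = G w"
    using step.IH by blast
  \<comment> \<open>Lifts are added as natural numbers without reduction: the power sums are linear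
    in the lift, and residues modulo \<open>p\<close> are compared only in the final proof.\<close>
  define g' where "g' = (\<lambda>P. (if P \<in> pg_points \<and> P \<subseteq> l then n else 0) + g P)"
  show ?case
  proof (intro exI[of _ g'] conjI allI impI)
    fix P show "((\<lambda>P. c * x P) + y) P = of_nat (g' P)"
      by (simp add: g'_def g c x char_vec_def)
  next
    fix k :: nat assume k: "0 < k" "k + 2 \<le> CARD('a)"
    obtain G where G: "G \<in> forms_at v k" "\<And>w. w \<notin> vec.span {v} \<Longrightarrow>
      (\<Sum>t\<in>UNIV. of_nat (g (vec.span {w + (t - w $ i) *s v})) * t ^ k) = G w"
      using psum[OF k] by blast
    obtain L where L: "L \<in> forms_at v k" "\<And>w. (\<Sum>t | w + (t - w $ i) *s v \<in> l. t ^ k) = L w"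
      using line_power_sum[OF assms(1) l k] by blast
    show "\<exists>G \<in> forms_at v k. \<forall>w. w \<notin> vec.span {v} \<longrightarrow>
      (\<Sum>t\<in>UNIV. of_nat (g' (vec.span {w + (t - w $ i) *s v})) * t ^ k) = G w"
    proof (intro bexI allI impI)
      show "(\<lambda>w. of_nat n * L w) + G \<in> forms_at v k"
        by (intro forms_at_add forms_at_scale G L)
    next
      fix w assume w: "w \<notin> vec.span {v}"
      \<comment> \<open>Since \<open>w\<close> is outside the span of \<open>v\<close>, these
        vectors are nonzero and span points, so the membership test in \<open>g'\<close> reduces to
        incidence with \<open>l\<close>.\<close>
      have "vec.span {w + t *s v} \<in> pg_points" for t
        using add_scale_notin_span[OF w, of t] vec.span_zero[of "{v}"]
        by (intro span_in_pg_points notI) simp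
      then have g': "g' (vec.span {w + t *s v})
          = (if w + t *s v \<in> l then n else 0) + g (vec.span {w + t *s v})" for t
        using pg_lines_span_subset_iff[OF l] by (simp add: g'_def)
      have "(\<Sum>t\<in>UNIV. of_nat (if w + (t - w $ i) *s v \<in> l then n else 0) * t ^ k)
          = (\<Sum>t | w + (t - w $ i) *s v \<in> l. of_nat n * t ^ k)"
        by (rule sum.mono_neutral_cong_right) auto
      also have "\<dots> = of_nat n * L w" by (simp only: L(2) flip: sum_distrib_left)
      finally show "(\<Sum>t\<in>UNIV. of_nat (g' (vec.span {w + (t - w $ i) *s v})) * t ^ k)
          = ((\<lambda>w. of_nat n * L w) + G) w"
        by (simp only: g' of_nat_add distrib_right sum.distrib G(2)[OF w] plus_fun_apply)
    qed
  qed
qed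

section \<open>Characteristic of finite fields\<close>

text \<open>Translation by 1 permutes the field, so comparing the two sums over it gives that the
  field size is 0 in the field. The characteristic is therefore a prime dividing
  \<open>p ^ h\<close>.\<close>

lemma CHAR_finite_field:
  assumes "prime p" "CARD('a::{field,finite}) = p ^ h"
  shows "CHAR('a) = p"
proof -
  have "(\<Sum>x\<in>UNIV. x + 1 :: 'a) = (\<Sum>x\<in>UNIV. x)"
    by (rule sum.reindex_bij_witness[of _ "\<lambda>x. x - 1" "\<lambda>x. x + 1"]) auto
  then have "of_nat CARD('a) = (0 :: 'a)" by (simp add: sum.distrib)
  then have "CHAR('a) dvd p ^ h" by (simp only: of_nat_eq_0_iff_char_dvd assms(2))
  moreover have "prime CHAR('a)"
    by (rule prime_CHAR_semidom) (simp add: finite_imp_CHAR_pos)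
  ultimately show ?thesis using assms(1) prime_dvd_power primes_dvd_imp_eq by blast
qed

lemma surj_of_nat_prime_field:
  assumes "prime p" "CARD('k::{field,finite}) = p"
  shows "surj (of_nat :: nat \<Rightarrow> 'k)"
proof -
  have char: "CHAR('k) = p" using CHAR_finite_field[of p 1] assms by simp
  have "inj_on (of_nat :: nat \<Rightarrow> 'k) {..<p}"
    by (auto simp: inj_on_def of_nat_eq_iff_cong_CHAR char cong_def)
  then have "card ((of_nat :: nat \<Rightarrow> 'k) ` {..<p}) = CARD('k)"
    using assms by (simp add: card_image)
  then have "(of_nat :: nat \<Rightarrow> 'k) ` {..<p} = UNIV" by (intro card_subset_eq) auto
  then show ?thesis by blast
qed

section \<open>Counting points on a line through \<open>Q\<close>\<close>

text \<open>Distinct parameters \<open>t\<close> give distinct points of \<open>l\<close>, none of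
  them the span of \<open>v\<close>. This carries the bound on the points of \<open>X\<close> over
  to the set of parameters whose elementary symmetric functions are taken.\<close>

lemma card_points_through:
  fixes v :: "'a::{field,finite} ^ 3"
  assumes "v $ i = 1" "l \<in> pg_lines" "vec.span {v} \<subseteq> l" "w \<in> l" "w \<notin> vec.span {v}"
  shows "card {t. vec.span {w + (t - w $ i) *s v} \<in> X} \<le> card {P \<in> X - {vec.span {v}}. P \<subseteq> l}"
proof (rule card_inj_on_le)
  let ?u = "\<lambda>t. w + (t - w $ i) *s v"
  have l: "vec.subspace l" using assms by (simp add: pg_lines_def)
  have v: "v \<in> l" using assms(3) vec.span_base by blast
  show "inj_on (\<lambda>t. vec.span {?u t}) {t. vec.span {?u t} \<in> X}"
  proof (rule inj_onI)
    fix s t assume "vec.span {?u s} = vec.span {?u t}"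
    then have "?u s \<in> vec.span {?u t}" by (metis vec.span_base singletonI)
    then obtain c where c: "?u s = c *s ?u t" unfolding vec.span_singleton by blast
    \<comment> \<open>The \<open>i\<close>-th coordinates of the two vectors are \<open>s\<close>
      and \<open>t\<close>. It remains to exclude \<open>c \<noteq> 1\<close>, which would make
      \<open>w\<close> a multiple of \<open>v\<close>.\<close>
    have st: "s = c * t"
      using arg_cong[OF c, of "\<lambda>x. x $ i"] assms(1) by simp
    have "c = 1"
    proof (rule ccontr)
      assume "c \<noteq> 1"
      have "(1 - c) *s w = (c * (t - w $ i) - (s - w $ i)) *s v"
        using c by (simp add: vec_eq_iff algebra_simps)
      then have "inverse (1 - c) *s ((1 - c) *s w)
          = inverse (1 - c) *s ((c * (t - w $ i) - (s - w $ i)) *s v)" by simp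
      then have "w = (inverse (1 - c) * (c * (t - w $ i) - (s - w $ i))) *s v"
        using \<open>c \<noteq> 1\<close> unfolding vec.scale_scale by simp
      then show False using assms(5) unfolding vec.span_singleton by blast
    qed
    then show "s = t" using st by simp
  qed
  show "(\<lambda>t. vec.span {?u t}) ` {t. vec.span {?u t} \<in> X} \<subseteq> {P \<in> X - {vec.span {v}}. P \<subseteq> l}"
  proof -
    have "vec.span {?u t} \<noteq> vec.span {v}" for t
      using add_scale_notin_span[OF assms(5)] vec.span_base by blast
    moreover have "?u t \<in> l" for t
      using l v assms(4) by (intro vec.subspace_add vec.subspace_scale)
    ultimately show ?thesis using pg_lines_span_subset_iff[OF assms(2)] by blast
  qed
qed simp

section \<open>Construction of the curve\<close>

theorem theorem5p4:
  fixes p q h :: nat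
    and X :: "('a::{field,finite} ^ 3) set set"
    and Q :: "('a ^ 3) set"
    and lam :: int
    and E :: "('a ^ 3) set set"
  assumes "prime p" and "h > 0" and "q = p ^ h"
    and "CARD('a) = q"
    and "CARD('k::{field,finite}) = p"
    and "X \<subseteq> pg_points"
    and "(char_vec X :: ('a ^ 3) set \<Rightarrow> 'k) \<in> line_code"
    and "Q \<in> pg_points"
    and "lam \<le> min (int q - 2) (int p - 1)"
    and "E \<noteq> {}"
    and "E \<subseteq> {l \<in> pg_lines. Q \<subseteq> l}"
    and "\<forall>l\<in>E. int (card {P \<in> X - {Q}. P \<subseteq> l}) \<le> lam"
  shows "\<exists>(n::nat) (f :: 'a poly3). int n = lam \<and> pg_curve n f \<and>
           (\<forall>P \<in> X - {Q}. (\<exists>l\<in>E. P \<subseteq> l) \<longrightarrow> on_curve P f)"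
proof -
  have char_a: "CHAR('a) = p" and char_k: "CHAR('k) = p"
    using CHAR_finite_field[where 'a = 'a, of p h] CHAR_finite_field[where 'a = 'k, of p 1] assms
    by simp_all
  obtain v0 where v0: "v0 \<in> Q" "v0 \<noteq> 0"
  proof -
    have "\<not> Q \<subseteq> {0}" using assms(8) vec.dim_eq_0[of Q] by (auto simp: pg_points_def)
    then show thesis using that by blast
  qed
  then obtain i where i: "v0 $ i \<noteq> 0" by (auto simp: vec_eq_iff)
  define v where "v = inverse (v0 $ i) *s v0"
  have v_i: "v $ i = 1" using i by (simp add: v_def)
  have "v \<in> Q" using v0 assms(8) by (auto simp: v_def pg_points_def intro: vec.subspace_scale)
  moreover have "v \<noteq> 0" using v_i by auto
  ultimately have Q: "Q = vec.span {v}" using assms(8) by (intro pg_point_eq_span)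
  \<comment> \<open>Some line in \<open>E\<close> has at most \<open>lam\<close> points of the given
    kind, so \<open>lam\<close> is nonnegative and can serve as a degree.\<close>
  obtain l0 where "l0 \<in> E" using assms(10) by blast
  then have "lam \<ge> 0" using assms(12) by fastforce
  define n where "n = nat lam"
  \<comment> \<open>The bound by \<open>q - 2\<close> makes the power sums up to exponent
    \<open>n\<close> available; the bound by \<open>p - 1\<close> makes every \<open>k\<close> from
    1 to \<open>n\<close> invertible in Newton's identities.\<close>
  have n: "int n = lam" "n + 2 \<le> CARD('a)" "n < p"
    using \<open>lam \<ge> 0\<close> assms(4,9) by (auto simp: n_def)
  \<comment> \<open>\<open>B w\<close> lists the points of \<open>X\<close> other than
    \<open>Q\<close> on the line joining \<open>w\<close> to \<open>Q\<close>, by the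
    \<open>i\<close>-th coordinates of suitably scaled spanning vectors. On \<open>D\<close> that
    line belongs to \<open>E\<close>, hence \<open>card_B\<close>.\<close>
  define B where "B = (\<lambda>w. {t. vec.span {w + (t - w $ i) *s v} \<in> X})"
  define D where "D = {w. w \<notin> Q \<and> (\<exists>l\<in>E. w \<in> l)}"
  have card_B: "card (B w) \<le> n" if "w \<in> D" for w
  proof -
    from that obtain l where l: "l \<in> E" "w \<in> l" "w \<notin> Q" by (auto simp: D_def)
    then have "card (B w) \<le> card {P \<in> X - {Q}. P \<subseteq> l}"
      unfolding B_def Q using assms(11) Q by (intro card_points_through v_i) auto
    then show ?thesis using assms(12) l(1) n(1) by fastforce
  qed
  obtain g where g: "\<And>P. (char_vec X P :: 'k) = of_nat (g P)"
    and psum: "\<And>k. 0 < k \<Longrightarrow> k + 2 \<le> CARD('a) \<Longrightarrow> \<exists>G \<in> forms_at v k. \<forall>w. w \<notin> Q \<longrightarrow>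
      (\<Sum>t\<in>UNIV. of_nat (g (vec.span {w + (t - w $ i) *s v})) * t ^ k) = G w"
    using line_code_power_sums[OF v_i surj_of_nat_prime_field[OF assms(1,5)] assms(7)]
    unfolding Q by blast
  have g_a: "(of_nat (g P) :: 'a) = (if P \<in> X then 1 else 0)" for P
  proof -
    have "(of_nat (g P) :: 'k) = of_nat (if P \<in> X then 1 else 0)"
      using g[of P, symmetric] by (simp add: char_vec_def)
    \<comment> \<open>Both fields have characteristic \<open>p\<close>, so equality of images of
      natural numbers is the same congruence modulo \<open>p\<close> in either of them.\<close>
    then have "(of_nat (g P) :: 'a) = of_nat (if P \<in> X then 1 else 0)"
      unfolding of_nat_eq_iff_cong_CHAR char_a char_k .
    then show ?thesis by simp
  qed
  have "\<exists>H \<in> forms_at v k. (\<forall>w\<in>D. esym (B w) k = H w) \<and> (k = 0 \<longrightarrow> H v = 1)" if "k \<le> n" for k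
  proof (rule esym_forms[OF _ _ _ that])
    show "of_nat k \<noteq> (0 :: 'a)" if "0 < k" "k \<le> n" for k
      using that n(3) unfolding of_nat_eq_0_iff_char_dvd char_a by (auto dest: dvd_imp_le)
  next
    fix k :: nat assume k: "0 < k" "k \<le> n"
    then have k2: "k + 2 \<le> CARD('a)" using n(2) by simp
    have "(\<Sum>t\<in>UNIV. of_nat (g (vec.span {w + (t - w $ i) *s v})) * t ^ k) = (\<Sum>t\<in>B w. t ^ k)" for w
      by (rule sum.mono_neutral_cong_right) (auto simp: B_def g_a)
    then show "\<exists>G \<in> forms_at v k. \<forall>w\<in>D. (\<Sum>b\<in>B w. b ^ k) = G w"
      using psum[OF k(1) k2] unfolding D_def by auto
  qed simp
  then obtain H where H: "\<And>k. k \<le> n \<Longrightarrow> H k \<in> forms_at v k" "H 0 v = 1"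
    "\<And>k w. k \<le> n \<Longrightarrow> w \<in> D \<Longrightarrow> esym (B w) k = H k w"
    by (metis le0)
  \<comment> \<open>On \<open>D\<close> this equals the product of the \<open>w $ i - b\<close> over
    \<open>b \<in> B w\<close>, times a power of \<open>w $ i\<close> that raises the degree to
    \<open>n\<close>.\<close>
  define F where "F = (\<lambda>w. \<Sum>k\<le>n. (-1) ^ k * (H k * (\<lambda>w. (w $ i) ^ (n - k))) w)"
  have "F \<in> forms n"
    unfolding F_def
  proof (intro forms_sum forms_scale)
    fix k assume k: "k \<in> {..n}"
    have "(\<lambda>w. (w $ i) ^ (n - k)) \<in> forms (n - k)"
      using forms_power[OF forms_coordinate[of i], of "n - k"] by simp
    then have "H k * (\<lambda>w. (w $ i) ^ (n - k)) \<in> forms (k + (n - k))"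
      using H(1)[of k] k by (intro forms_mult) (auto simp: forms_at_def)
    then show "H k * (\<lambda>w. (w $ i) ^ (n - k)) \<in> forms n" using k by simp
  qed
  then obtain f where f: "homogeneous3 n f" "\<And>w. poly3_eval f w = F w"
    using forms_poly3 by blast
  have "F v = (\<Sum>k\<le>n. if k = 0 then 1 else 0)"
    unfolding F_def using H(1,2) v_i by (intro sum.cong) (auto simp: forms_at_def)
  then have "F v = 1" by simp
  then have "f \<noteq> 0" using f(2)[of v] by (auto simp: poly3_eval_def)
  moreover have "on_curve P f" if P: "P \<in> X - {Q}" and l: "l \<in> E" "P \<subseteq> l" for P l
    unfolding on_curve_def
  proof
    fix w assume w: "w \<in> P - {0}"
    have "P \<in> pg_points" using P assms(6) by blast
    then have P_eq: "P = vec.span {w}" using w by (intro pg_point_eq_span) auto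
    have "w \<notin> Q"
      using pg_point_eq_span[OF assms(8), of w] w P P_eq by auto
    then have D: "w \<in> D" using l w by (auto simp: D_def)
    \<comment> \<open>The parameter \<open>t = w $ i\<close> gives back \<open>w\<close> itself,
      whose span \<open>P\<close> is in \<open>X\<close>.\<close>
    have "w $ i \<in> B w" using P P_eq by (simp add: B_def)
    then have "(\<Sum>k\<le>n. (-1) ^ k * esym (B w) k * (w $ i) ^ (n - k)) = 0"
      using card_B[OF D] by (intro esym_root) simp_all
    then have "F w = 0"
      unfolding F_def using H(3) D by (simp add: mult.assoc)
    then show "poly3_eval f w = 0" by (simp add: f(2))
  qed
  ultimately show ?thesis
    using f(1) n(1) by (intro exI[of _ n] exI[of _ f]) (auto simp: pg_curve_def)
qed

end
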